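(* Let $k\ge 0$ be a fixed integer and let $z_{t,j}=\sum_{h=0}^{k}\beta_{h,j}f_{t-h}+e_{t,j}$ be a dynamic factor model with one dynamic factor, as set up in the context, satisfying the following assumptions, where $\boldsymbol{\chi}_t=\boldsymbol{\beta}^{\prime}\mathbf{f}_t$ denotes the ($m$-dimensional) common part and $\mathbf{e}_t$ the ($m$-dimensional) idiosyncratic part. (1a) For each $m$, $\boldsymbol{\chi}_t$ and $\mathbf{e}_t$ are zero-mean, second-order stationary $m$-dimensional processes that have a spectral density. (1b) $\mathbf{f}_t$ is second-order stationary, and $\mathbf{f}_t$ and $\mathbf{e}_t$ are uncorrelated for all $t$. (1c) Let $\boldsymbol{\Sigma}^{\boldsymbol{\chi}}$ and $\boldsymbol{\Sigma}^{\mathbf{e}}$ be the covariance matrices of $\boldsymbol{\chi}_t$ and $\mathbf{e}_t$, let $\lambda^{\boldsymbol{\chi}}_{m,j}$ and $\lambda^{\mathbf{e}}_{m,j}$ be their respective $j$-th largest eigenvalues, and put $\lambda^{\boldsymbol{\chi}}_{j}=\sup_{m\in\mathbb{N}}\lambda^{\boldsymbol{\chi}}_{m,j}$ and $\lambda^{\mathbf{e}}_{j}=\sup_{m\in\mathbb{N}}\lambda^{\mathbf{e}}_{m,j}$. Then $\lambda^{\boldsymbol{\chi}}_{k+1}=\infty$ and $\lambda^{\mathbf{e}}_{1}<\infty$. (2a) $(\boldsymbol{\beta}\boldsymbol{\beta}^{\prime})/m\to\mathbf{I}_{k+1}$ as $m\to\infty$. (2b) $\limsup_{m}\sum_{u\in\mathbb{Z}}\left(\mathbb{E}\,\mathbf{e}_t^{\prime}\mathbf{e}_{t+u}/m\right)^2<\infty$.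 (2c) $\limsup_{m}\,(1/m)\sup_{t,s\in\mathbb{Z}}\sum_{j=1}^{m}\sum_{i=1}^{m}\left|\operatorname{cov}(e_{t,i}e_{s,i},\,e_{t,j}e_{s,j})\right|<\infty$. For each $T$ and $m$, let $(\widehat{\mathbf{f}},\widehat{\boldsymbol{\alpha}},\widehat{\boldsymbol{\beta}})$ be the first generalized dynamic principal component of the data $\mathbf{z}_1,\dots,\mathbf{z}_T$ with its corresponding intercepts and loadings, defined using $\widehat{k}=k$ lags, and let $\widehat{\mathbf{z}}_t(\widehat{\mathbf{f}},\widehat{\boldsymbol{\alpha}},\widehat{\boldsymbol{\beta}})$ be the resulting reconstruction of $\mathbf{z}_t$. Then, as $T\to\infty$ and $m\to\infty$, $$\frac{1}{Tm}\sum_{t=1}^{T}\left\Vert \boldsymbol{\chi}_t-\widehat{\mathbf{z}}_t(\widehat{\mathbf{f}},\widehat{\boldsymbol{\alpha}},\widehat{\boldsymbol{\beta}})\right\Vert^2=O_P\left(\frac{1}{\min\left(T^{1/4},m^{1/4}\right)}\right).$$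
   Context: **Model.** $\{z_{t,j}: t\in\mathbb{Z}, j\in\mathbb{N}\}$ is a double-indexed real stochastic process satisfying $z_{t,j}=\sum_{h=0}^{k}\beta_{h,j}f_{t-h}+e_{t,j}$, where $f_t$ ($t\in\mathbb{Z}$) and $e_{t,j}$ ($t\in\mathbb{Z}$, $j\in\mathbb{N}$) are real random variables and the factor loadings $\beta_{h,j}$ ($0\le h\le k$, $j\in\mathbb{N}$) are real constants. The variables $z_{t,j}$ are observed for $1\le t\le T$, $1\le j\le m$. For given $m$, write $\mathbf{z}_t=(z_{t,1},\dots,z_{t,m})^{\prime}$, $\mathbf{e}_t=(e_{t,1},\dots,e_{t,m})^{\prime}$, $\mathbf{f}_t=(f_t,f_{t-1},\dots,f_{t-k})^{\prime}\in\mathbb{R}^{k+1}$, and let $\boldsymbol{\beta}\in\mathbb{R}^{(k+1)\times m}$ be the matrix with entries $\beta_{h,j}$, $0\le h\le k$, $1\le j\le m$. Thus $\mathbf{z}_t=\boldsymbol{\beta}^{\prime}\mathbf{f}_t+\mathbf{e}_t=\boldsymbol{\chi}_t+\mathbf{e}_t$. The dependence of $\mathbf{z}_t,\mathbf{e}_t,\boldsymbol{\chi}_t,\boldsymbol{\beta}$ on $m$ is suppressed in the notation. A prime denotes transpose and $\Vert\cdot\Vert$ is the Euclidean norm. **Generalized dynamic principal component (GDPC) with $k$ lags.** For $\check{\mathbf{f}}=(\check f_{1-k},\dots,\check f_T)^{\prime}\in\mathbb{R}^{T+k}$, $\check{\boldsymbol{\alpha}}=(\check\alpha_1,\dots,\check\alpha_m)^{\prime}\in\mathbb{R}^m$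 and $\check{\boldsymbol{\beta}}\in\mathbb{R}^{(k+1)\times m}$ with entries $\check\beta_{h,j}$, define the reconstruction $\widehat{\mathbf{z}}_t(\check{\mathbf{f}},\check{\boldsymbol{\alpha}},\check{\boldsymbol{\beta}})\in\mathbb{R}^m$, $t=1,\dots,T$, by its coordinates $$\widehat z_{t,j}(\check{\mathbf{f}},\check{\boldsymbol{\alpha}},\check{\boldsymbol{\beta}})=\check\alpha_j+\sum_{h=0}^{k}\check\beta_{h,j}\check f_{t-h},\quad j=1,\dots,m,$$ and the reconstruction mean squared error $$\mathrm{MSE}(\check{\mathbf{f}},\check{\boldsymbol{\alpha}},\check{\boldsymbol{\beta}})=\frac{1}{Tm}\sum_{t=1}^{T}\Vert\mathbf{z}_t-\widehat{\mathbf{z}}_t(\check{\mathbf{f}},\check{\boldsymbol{\alpha}},\check{\boldsymbol{\beta}})\Vert^2.$$ The first GDPC of the data using $k$ lags is the vector $\widehat{\mathbf{f}}\in\mathbb{R}^{T+k}$ with zero mean and unit variance (meaning the sample mean and sample variance of its $T+k$ entries) such that, for some optimal $\widehat{\boldsymbol{\alpha}}\in\mathbb{R}^m$ and $\widehat{\boldsymbol{\beta}}\in\mathbb{R}^{(k+1)\times m}$, the reconstruction mean squared error is minimal. That is, $(\widehat{\mathbf{f}},\widehat{\boldsymbol{\alpha}},\widehat{\boldsymbol{\beta}})$ minimizes $\mathrm{MSE}$ over all $(\check{\mathbf{f}},\check{\boldsymbol{\alpha}},\check{\boldsymbol{\beta}})$ with $\check{\mathbf{f}}$ of zero mean and unit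 variance; $\widehat{\boldsymbol{\alpha}}$ and $\widehat{\boldsymbol{\beta}}$ are its corresponding intercepts and loadings. **Asymptotics.** $T$ and $m$ diverge jointly, with no restriction on their relative rates. $X_{T,m}=O_P(a_{T,m})$ means that for every $\varepsilon>0$ there are $M,T_0,m_0$ such that $P(|X_{T,m}|>M a_{T,m})<\varepsilon$ for all $T\ge T_0$ and $m\ge m_0$. *)

theory Defs
  imports "HOL-Probability.Probability" "Jordan_Normal_Form.Char_Poly"
begin

text \<open>
  A vector process whose coordinates are indexed by a finite set \<open>I\<close> of naturals is a function
  \<open>x :: int \<Rightarrow> nat \<Rightarrow> 'a \<Rightarrow> real\<close> taking a time, a coordinate and an outcome; only the
  coordinates in \<open>I\<close> matter. Cross-sectional coordinates are numbered from 1, lags from 0.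
\<close>

definition cov :: "'a measure \<Rightarrow> ('a \<Rightarrow> real) \<Rightarrow> ('a \<Rightarrow> real) \<Rightarrow> real" where
  "cov M X Y = (\<integral>\<omega>. (X \<omega> - (\<integral>\<omega>'. X \<omega>' \<partial>M)) * (Y \<omega> - (\<integral>\<omega>'. Y \<omega>' \<partial>M)) \<partial>M)"

definition zero_mean :: "'a measure \<Rightarrow> nat set \<Rightarrow> (int \<Rightarrow> nat \<Rightarrow> 'a \<Rightarrow> real) \<Rightarrow> bool" where
  "zero_mean M I x \<longleftrightarrow> (\<forall>t. \<forall>i\<in>I. (\<integral>\<omega>. x t i \<omega> \<partial>M) = 0)"

definition second_order_stationary ::
    "'a measure \<Rightarrow> nat set \<Rightarrow> (int \<Rightarrow> nat \<Rightarrow> 'a \<Rightarrow> real) \<Rightarrow> bool" where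
  "second_order_stationary M I x \<longleftrightarrow>
     (\<forall>t. \<forall>i\<in>I. x t i \<in> borel_measurable M \<and> integrable M (\<lambda>\<omega>. (x t i \<omega>)\<^sup>2)) \<and>
     (\<forall>s t. \<forall>i\<in>I. (\<integral>\<omega>. x s i \<omega> \<partial>M) = (\<integral>\<omega>. x t i \<omega> \<partial>M)) \<and>
     (\<forall>s t u. \<forall>i\<in>I. \<forall>j\<in>I. cov M (x (s + u) i) (x s j) = cov M (x (t + u) i) (x t j))"

text \<open>
  A spectral density is a Hermitian nonnegative definite, integrable matrix function \<open>S\<close> on
  \<open>[-\<pi>, \<pi>]\<close> whose Fourier coefficients are the autocovariances. Given the Hermitian symmetry,
  the quadratic form below is real, so only its real part is constrained.
\<close>

definition has_spectral_density ::
    "'a measure \<Rightarrow> nat set \<Rightarrow> (int \<Rightarrow> nat \<Rightarrow> 'a \<Rightarrow> real) \<Rightarrow> bool" where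
  "has_spectral_density M I x \<longleftrightarrow>
     (\<exists>S :: real \<Rightarrow> nat \<Rightarrow> nat \<Rightarrow> complex.
        (\<forall>\<theta>\<in>{-pi..pi}. \<forall>i\<in>I. \<forall>j\<in>I. S \<theta> j i = cnj (S \<theta> i j)) \<and>
        (\<forall>\<theta>\<in>{-pi..pi}. \<forall>v :: nat \<Rightarrow> complex.
           0 \<le> Re (\<Sum>i\<in>I. \<Sum>j\<in>I. cnj (v i) * S \<theta> i j * v j)) \<and>
        (\<forall>i\<in>I. \<forall>j\<in>I. set_integrable lborel {-pi..pi} (\<lambda>\<theta>. S \<theta> i j)) \<and>
        (\<forall>t u. \<forall>i\<in>I. \<forall>j\<in>I.
           complex_of_real (cov M (x (t + u) i) (x t j)) =
           (LINT \<theta>:{-pi..pi}|lborel. exp (\<i> * of_int u * of_real \<theta>) * S \<theta> i j)))"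

definition cov_matrix ::
    "'a measure \<Rightarrow> nat \<Rightarrow> (int \<Rightarrow> nat \<Rightarrow> 'a \<Rightarrow> real) \<Rightarrow> int \<Rightarrow> real mat" where
  "cov_matrix M m x t =
     Matrix.mat m m (\<lambda>(i, j). cov M (x t (Suc i)) (x t (Suc j)))"

text \<open>
  The \<open>j\<close>-th largest eigenvalue, \<open>1 \<le> j \<le> n\<close>, of a symmetric real \<open>n \<times> n\<close> matrix, counted
  with multiplicity: the characteristic polynomial of such a matrix splits over the reals.
\<close>

definition nth_largest_eigenvalue :: "real mat \<Rightarrow> nat \<Rightarrow> real" where
  "nth_largest_eigenvalue A j = rev (sorted_list_of_multiset (proots (char_poly A))) ! (j - 1)"

text \<open>The supremum ranges over those \<open>m\<close> for which a \<open>j\<close>-th eigenvalue exists.\<close>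

definition sup_eigenvalue ::
    "'a measure \<Rightarrow> (int \<Rightarrow> nat \<Rightarrow> 'a \<Rightarrow> real) \<Rightarrow> int \<Rightarrow> nat \<Rightarrow> ereal" where
  "sup_eigenvalue M x t j = (SUP m\<in>{j..}. ereal (nth_largest_eigenvalue (cov_matrix M m x t) j))"

definition lag_vector :: "(int \<Rightarrow> 'a \<Rightarrow> real) \<Rightarrow> int \<Rightarrow> nat \<Rightarrow> 'a \<Rightarrow> real" where
  "lag_vector f t h = f (t - int h)"

definition common_part ::
    "nat \<Rightarrow> (nat \<Rightarrow> nat \<Rightarrow> real) \<Rightarrow> (int \<Rightarrow> 'a \<Rightarrow> real) \<Rightarrow> int \<Rightarrow> nat \<Rightarrow> 'a \<Rightarrow> real" where
  "common_part k \<beta> f t j \<omega> = (\<Sum>h=0..k. \<beta> h j * lag_vector f t h \<omega>)"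

text \<open>
  In the deterministic notions below, candidate factors \<open>g\<close> are functions on the integers of which
  only the values at \<open>1 - k, \<dots>, T\<close> matter; likewise only \<open>a j\<close> and \<open>b h j\<close> with
  \<open>1 \<le> j \<le> m\<close> and \<open>h \<le> k\<close> matter.
\<close>

definition reconstruction ::
    "nat \<Rightarrow> (int \<Rightarrow> real) \<Rightarrow> (nat \<Rightarrow> real) \<Rightarrow> (nat \<Rightarrow> nat \<Rightarrow> real) \<Rightarrow> int \<Rightarrow> nat \<Rightarrow> real" where
  "reconstruction k g a b t j = a j + (\<Sum>h=0..k. b h j * g (t - int h))"

definition reconstruction_MSE ::
    "nat \<Rightarrow> nat \<Rightarrow> nat \<Rightarrow> (int \<Rightarrow> nat \<Rightarrow> real) \<Rightarrow>
     (int \<Rightarrow> real) \<Rightarrow> (nat \<Rightarrow> real) \<Rightarrow> (nat \<Rightarrow> nat \<Rightarrow> real) \<Rightarrow> real" where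
  "reconstruction_MSE k T m z g a b =
     1 / (real T * real m) *
     (\<Sum>t=1..int T. (L2_set (\<lambda>j. z t j - reconstruction k g a b t j) {1..m})\<^sup>2)"

text \<open>Sample mean 0 and sample variance 1, the latter with divisor the sample size \<open>T + k\<close>.\<close>

definition standardized :: "nat \<Rightarrow> nat \<Rightarrow> (int \<Rightarrow> real) \<Rightarrow> bool" where
  "standardized k T g \<longleftrightarrow>
     (let mean = (\<Sum>s=1 - int k..int T. g s) / real (T + k)
      in mean = 0 \<and> (\<Sum>s=1 - int k..int T. (g s - mean)\<^sup>2) / real (T + k) = 1)"

definition is_first_gdpc ::
    "nat \<Rightarrow> nat \<Rightarrow> nat \<Rightarrow> (int \<Rightarrow> nat \<Rightarrow> real) \<Rightarrow>
     (int \<Rightarrow> real) \<Rightarrow> (nat \<Rightarrow> real) \<Rightarrow> (nat \<Rightarrow> nat \<Rightarrow> real) \<Rightarrow> bool" where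
  "is_first_gdpc k T m z g a b \<longleftrightarrow>
     standardized k T g \<and>
     (\<forall>g' a' b'. standardized k T g' \<longrightarrow>
        reconstruction_MSE k T m z g a b \<le> reconstruction_MSE k T m z g' a' b')"

definition bigO_P ::
    "'a measure \<Rightarrow> (nat \<Rightarrow> nat \<Rightarrow> 'a \<Rightarrow> real) \<Rightarrow> (nat \<Rightarrow> nat \<Rightarrow> real) \<Rightarrow> bool" where
  "bigO_P M X a \<longleftrightarrow>
     (\<forall>\<epsilon>>0. \<exists>C T0 m0. \<forall>T\<ge>T0. \<forall>m\<ge>m0.
        measure M {\<omega>\<in>space M. \<bar>X T m \<omega>\<bar> > C * a T m} < \<epsilon>)"

end

theory Submission
  imports Defs
begin

text \<open>
  Write \<open>\<chi>\<close>, \<open>e\<close> and \<open>D\<close> for the \<open>T \<times> m\<close> matrices of the common part, the idiosyncratic part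
  and the error \<open>\<chi> - zhat\<close> of the fitted reconstruction.

  The common part can itself be reconstructed exactly from a standardized factor: shift and scale
  the true factor to sample mean 0 and sample variance 1, and let intercepts and loadings undo
  this (lemma \<open>exists_standardized_reconstruction\<close>). As the fitted reconstruction is optimal,
  \<open>\<parallel>D + e\<parallel>\<^sup>2 \<le> \<parallel>e\<parallel>\<^sup>2\<close>, that is, \<open>\<parallel>D\<parallel>\<^sup>2 \<le> -2 \<langle>D, e\<rangle>\<close> in the Frobenius inner product.

  The inner product is small because \<open>D\<close> has bounded rank: its columns are combinations of
  the \<open>k + 1\<close> lags of the true factor, the \<open>k + 1\<close> lags of the fitted one, and a constant. So
  \<open>\<langle>D, e\<rangle>\<^sup>2 \<le> (2k + 3) \<parallel>e\<parallel>\<^sub>o\<^sub>p\<^sup>2 \<parallel>D\<parallel>\<^sup>2\<close> (lemma \<open>low_rank_inner_product_bound\<close>), which gives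
  \<open>\<parallel>D\<parallel>\<^sup>2 \<le> 4 (2k + 3) \<parallel>e\<parallel>\<^sub>o\<^sub>p\<^sup>2\<close>. The squared operator norm is at most the Frobenius norm of the Gram
  matrix \<open>e e'\<close>, so that \<open>\<parallel>D\<parallel>\<^sup>2 \<le> 4 (2k + 3) sqrt Y\<close> with \<open>Y = \<Sum>\<^sub>t\<^sub>,\<^sub>s (e\<^sub>t' e\<^sub>s)\<^sup>2\<close>
  (lemma \<open>gdpc_error_bound\<close>). This bound is pathwise.

  Finally the second moment of \<open>e\<^sub>t' e\<^sub>s\<close> is its squared mean plus its variance. The squared means
  sum to \<open>O(T m\<^sup>2)\<close> since the autocovariances are square summable over lags, the variances sum to
  \<open>O(T\<^sup>2 m)\<close> since the cross-sectional dependence of the products is weak, and so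
  \<open>E Y = O(T\<^sup>2 m\<^sup>2 (1/T + 1/m))\<close> (lemma \<open>expected_gram_le\<close>). Markov's inequality then bounds
  \<open>\<parallel>D\<parallel>\<^sup>2 / (T m)\<close> by \<open>O\<^sub>P (min (T, m) powr (-1/2))\<close>, which is stronger than the rate claimed.
\<close>

section \<open>Inner products with matrices of low rank\<close>

text \<open>
  The hypothesis \<open>op\<close> says that \<open>E\<close> has squared operator norm at most \<open>G\<close>. The inequality is the
  duality between nuclear and operator norm combined with
  \<open>nuclear norm \<le> sqrt rank \<cdot> Frobenius norm\<close>. An elementary induction on the number of rank-one
  terms replaces the singular value decomposition: splitting off from \<open>D\<close> its projection onto
  one of the column vectors leaves an orthogonal remainder with one term fewer.
\<close>

lemma low_rank_inner_product_bound:
  fixes D E :: "'t \<Rightarrow> 'j \<Rightarrow> real"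
  assumes "finite R" "finite A" and G: "0 \<le> G"
    and op: "\<And>u. (\<Sum>j\<in>J. (\<Sum>t\<in>A. u t * E t j)\<^sup>2) \<le> G * (\<Sum>t\<in>A. (u t)\<^sup>2)"
    and D: "\<And>t j. t \<in> A \<Longrightarrow> j \<in> J \<Longrightarrow> D t j = (\<Sum>r\<in>R. c r t * v r j)"
  shows "(\<Sum>j\<in>J. \<Sum>t\<in>A. D t j * E t j)\<^sup>2 \<le> real (card R) * G * (\<Sum>j\<in>J. \<Sum>t\<in>A. (D t j)\<^sup>2)"
  using \<open>finite R\<close> D
proof (induction R arbitrary: D c rule: finite_induct)
  case empty
  then show ?case by simp
next
  case (insert r0 R)
  define n where "n = (\<Sum>t\<in>A. (c r0 t)\<^sup>2)"
  show ?case
  proof (cases "n = 0")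
    case True
    then have "c r0 t = 0" if "t \<in> A" for t
      using that \<open>finite A\<close> by (simp add: n_def sum_nonneg_eq_0_iff)
    then have "D t j = (\<Sum>r\<in>R. c r t * v r j)" if "t \<in> A" "j \<in> J" for t j
      using insert.prems[OF that] insert.hyps that by simp
    from insert.IH[of D c, OF this] have "(\<Sum>j\<in>J. \<Sum>t\<in>A. D t j * E t j)\<^sup>2
        \<le> real (card R) * G * (\<Sum>j\<in>J. \<Sum>t\<in>A. (D t j)\<^sup>2)" by blast
    also have "\<dots> \<le> real (card (insert r0 R)) * G * (\<Sum>j\<in>J. \<Sum>t\<in>A. (D t j)\<^sup>2)"
      using insert.hyps G by (intro mult_right_mono sum_nonneg) auto
    finally show ?thesis .
  next
    case False
    then have "n > 0" using sum_nonneg[of A "\<lambda>t. (c r0 t)\<^sup>2"] by (simp add: n_def)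
    define p where "p t = c r0 t / sqrt n" for t
    have p1: "(\<Sum>t\<in>A. (p t)\<^sup>2) = 1"
      using \<open>n > 0\<close> by (simp add: p_def power_divide flip: sum_divide_distrib n_def)
    have c_p: "c r0 t = sqrt n * p t" for t using \<open>n > 0\<close> by (simp add: p_def)
    define w where "w j = (\<Sum>t\<in>A. p t * D t j)" for j
    define q where "q r = (\<Sum>t\<in>A. p t * c r t)" for r
    define D' where "D' t j = D t j - p t * w j" for t j
    have w: "w j = sqrt n * v r0 j + (\<Sum>r\<in>R. q r * v r j)" if "j \<in> J" for j
    proof -
      have "w j = (\<Sum>t\<in>A. (p t)\<^sup>2 * (sqrt n * v r0 j) + (\<Sum>r\<in>R. p t * c r t * v r j))"
        unfolding w_def using insert.hyps that
        by (intro sum.cong refl)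
          (simp add: insert.prems c_p distrib_left sum_distrib_left power2_eq_square mult_ac)
      also have "\<dots> = sqrt n * v r0 j + (\<Sum>r\<in>R. q r * v r j)"
        unfolding sum.distrib sum_distrib_right[symmetric] p1 q_def
        by (subst sum.swap) (simp add: sum_distrib_right)
      finally show ?thesis .
    qed
    have "D' t j = (\<Sum>r\<in>R. (c r t - q r * p t) * v r j)" if "t \<in> A" "j \<in> J" for t j
      using insert.hyps that
      by (simp add: D'_def w insert.prems c_p sum_subtractf sum_distrib_left algebra_simps)
    from insert.IH[of D' "\<lambda>r t. c r t - q r * p t", OF this]
    have IH: "(\<Sum>j\<in>J. \<Sum>t\<in>A. D' t j * E t j)\<^sup>2
        \<le> real (card R) * G * (\<Sum>j\<in>J. \<Sum>t\<in>A. (D' t j)\<^sup>2)" by blast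
    \<comment> \<open>\<open>p\<close> is a unit vector orthogonal to the columns of \<open>D'\<close>, so norms obey Pythagoras.\<close>
    define N' W where "N' = (\<Sum>j\<in>J. \<Sum>t\<in>A. (D' t j)\<^sup>2)" and "W = (\<Sum>j\<in>J. (w j)\<^sup>2)"
    define a b where "a = (\<Sum>j\<in>J. w j * (\<Sum>t\<in>A. p t * E t j))"
      and "b = (\<Sum>j\<in>J. \<Sum>t\<in>A. D' t j * E t j)"
    have nn: "0 \<le> N'" "0 \<le> W" by (simp_all add: N'_def W_def sum_nonneg)
    have "(\<Sum>t\<in>A. (D t j)\<^sup>2) = (\<Sum>t\<in>A. (D' t j)\<^sup>2) + (w j)\<^sup>2" for j
    proof -
      have "(\<Sum>t\<in>A. (D' t j)\<^sup>2)
          = (\<Sum>t\<in>A. (D t j)\<^sup>2 - 2 * w j * (p t * D t j) + (w j)\<^sup>2 * (p t)\<^sup>2)"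
        by (intro sum.cong refl) (simp add: D'_def power2_eq_square algebra_simps)
      also have "\<dots> = (\<Sum>t\<in>A. (D t j)\<^sup>2) - 2 * w j * w j + (w j)\<^sup>2"
        by (simp add: sum.distrib sum_subtractf p1 flip: sum_distrib_left w_def)
      finally show ?thesis by (simp add: power2_eq_square)
    qed
    then have pyth: "(\<Sum>j\<in>J. \<Sum>t\<in>A. (D t j)\<^sup>2) = N' + W"
      by (simp add: N'_def W_def sum.distrib)
    have inner: "(\<Sum>j\<in>J. \<Sum>t\<in>A. D t j * E t j) = a + b"
      by (simp add: a_def b_def D'_def sum_subtractf sum_distrib_left algebra_simps)
    have "a\<^sup>2 \<le> W * (\<Sum>j\<in>J. (\<Sum>t\<in>A. p t * E t j)\<^sup>2)"
      unfolding a_def W_def by (rule Cauchy_Schwarz_ineq_sum)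
    also have "\<dots> \<le> W * G" using op[of p] nn by (intro mult_left_mono) (simp_all add: p1)
    finally have a: "a\<^sup>2 \<le> W * G" .
    have b: "b\<^sup>2 \<le> real (card R) * G * N'" using IH by (simp add: b_def N'_def)
    have "(a + b)\<^sup>2 \<le> (real (card R) + 1) * G * (N' + W)"
    proof (cases "card R = 0")
      case True
      with a b have "b = 0" by simp
      moreover have "0 \<le> G * N'" using G nn by simp
      ultimately show ?thesis using a True by (simp add: algebra_simps)
    next
      case False
      define K where "K = real (card R)"
      have "K > 0" using False by (simp add: K_def)
      \<comment> \<open>The Cauchy-Schwarz inequality \<open>(a + b)\<^sup>2 \<le> (1 + K) (a\<^sup>2 + b\<^sup>2 / K)\<close>, cleared of fractions.\<close>
      have "0 \<le> (K * a - b)\<^sup>2" by simp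
      then have "K * (a + b)\<^sup>2 \<le> K * (K + 1) * a\<^sup>2 + (K + 1) * b\<^sup>2"
        by (simp add: power2_eq_square algebra_simps)
      also have "\<dots> \<le> K * (K + 1) * (W * G) + (K + 1) * (K * G * N')"
        using a b \<open>K > 0\<close> by (intro add_mono mult_left_mono) (auto simp: K_def)
      also have "\<dots> = K * ((K + 1) * G * (N' + W))" by (simp add: algebra_simps)
      finally show ?thesis using \<open>K > 0\<close> by (simp add: K_def)
    qed
    then show ?thesis using insert.hyps by (simp add: inner pyth add.commute)
  qed
qed

text \<open>
  \<open>\<parallel>E' u\<parallel>\<^sup>2\<close> is the quadratic form of the Gram matrix \<open>E E'\<close> at \<open>u\<close>; Cauchy-Schwarz over pairs of
  indices bounds it by the Frobenius norm of that matrix.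
\<close>

lemma operator_norm_le_gram:
  fixes E :: "'t \<Rightarrow> 'j \<Rightarrow> real"
  shows "(\<Sum>j\<in>J. (\<Sum>t\<in>A. u t * E t j)\<^sup>2)
    \<le> sqrt (\<Sum>t\<in>A. \<Sum>s\<in>A. (\<Sum>j\<in>J. E t j * E s j)\<^sup>2) * (\<Sum>t\<in>A. (u t)\<^sup>2)"
proof -
  have "(\<Sum>j\<in>J. (\<Sum>t\<in>A. u t * E t j)\<^sup>2)
      = (\<Sum>j\<in>J. \<Sum>t\<in>A. \<Sum>s\<in>A. u t * u s * (E t j * E s j))"
    by (simp add: power2_eq_square sum_product mult_ac)
  also have "\<dots> = (\<Sum>t\<in>A. \<Sum>s\<in>A. u t * u s * (\<Sum>j\<in>J. E t j * E s j))"
    by (subst sum.swap, rule sum.cong[OF refl], subst sum.swap) (simp add: sum_distrib_left)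
  also have "\<dots> = (\<Sum>(t, s)\<in>A \<times> A. u t * u s * (\<Sum>j\<in>J. E t j * E s j))"
    by (simp add: sum.cartesian_product)
  also have "\<dots> \<le> sqrt ((\<Sum>(t, s)\<in>A \<times> A. (u t * u s)\<^sup>2) *
      (\<Sum>(t, s)\<in>A \<times> A. (\<Sum>j\<in>J. E t j * E s j)\<^sup>2))"
    using Cauchy_Schwarz_ineq_sum[of "\<lambda>(t, s). u t * u s" "\<lambda>(t, s). \<Sum>j\<in>J. E t j * E s j" "A \<times> A"]
    by (intro real_le_rsqrt) (simp add: case_prod_unfold)
  also have "(\<Sum>(t, s)\<in>A \<times> A. (u t * u s)\<^sup>2) = (\<Sum>t\<in>A. (u t)\<^sup>2)\<^sup>2"
    unfolding power2_eq_square[of "sum _ A"] 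
    by (simp add: sum_product power_mult_distrib flip: sum.cartesian_product)
  finally show ?thesis
    by (simp add: real_sqrt_mult sum_nonneg mult.commute flip: sum.cartesian_product)
qed

section \<open>The reconstruction error is controlled by the noise\<close>

lemma standardized_standardization:
  assumes "\<mu> = (\<Sum>s=1 - int k..int T. f s) / real (T + k)"
    and "V = (\<Sum>s=1 - int k..int T. (f s - \<mu>)\<^sup>2) / real (T + k)" "V > 0"
  shows "standardized k T (\<lambda>s. (f s - \<mu>) / sqrt V)"
proof -
  have pos: "real (T + k) > 0"
    using assms(2,3) by (cases "T + k = 0") auto
  have card: "real (card {1 - int k..int T}) = real (T + k)" by simp
  have "(\<Sum>s=1 - int k..int T. f s - \<mu>) = 0"
    unfolding sum_subtractf sum_constant card using pos by (simp add: assms(1))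
  then have mean: "(\<Sum>s=1 - int k..int T. (f s - \<mu>) / sqrt V) = 0"
    by (simp flip: sum_divide_distrib)
  have "(\<Sum>s=1 - int k..int T. ((f s - \<mu>) / sqrt V)\<^sup>2) / real (T + k)
      = ((\<Sum>s=1 - int k..int T. (f s - \<mu>)\<^sup>2) / real (T + k)) / V"
    using \<open>V > 0\<close> by (simp add: power_divide flip: sum_divide_distrib)
  also have "\<dots> = 1" using \<open>V > 0\<close> unfolding assms(2)[symmetric] by simp
  finally have "(\<Sum>s=1 - int k..int T. ((f s - \<mu>) / sqrt V)\<^sup>2) / real (T + k) = 1" .
  then show ?thesis
    using \<open>V > 0\<close> by (simp add: standardized_def Let_def mean)
qed

text \<open>
  Lag polynomials of an arbitrary factor are among the candidates that the principal component
  competes with, because intercept and loadings absorb location and scale. A factor that is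
  constant on the sample cannot be scaled to unit variance, but then its contribution is an
  intercept and zero loadings serve for any standardized \<open>g\<close>; two sample points are enough
  for one to exist.
\<close>

lemma exists_standardized_reconstruction:
  assumes "2 \<le> T + k"
  obtains g a b where "standardized k T g"
    "\<And>t j. 1 \<le> t \<Longrightarrow> t \<le> int T \<Longrightarrow>
      reconstruction k g a b t j = (\<Sum>h=0..k. \<beta> h j * f (t - int h))"
proof -
  let ?S = "{1 - int k..int T}"
  define mu where "mu g = (\<Sum>s\<in>?S. g s) / real (T + k)" for g :: "int \<Rightarrow> real"
  define var where "var g = (\<Sum>s\<in>?S. (g s - mu g)\<^sup>2) / real (T + k)" for g
  have std: "standardized k T (\<lambda>s. (g s - mu g) / sqrt (var g))" if "var g > 0" for g
    using that by (rule standardized_standardization[OF mu_def var_def])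
  have nn: "var g \<ge> 0" for g by (simp add: var_def sum_nonneg)
  have var0: "g s = mu g" if "var g = 0" "s \<in> ?S" for g s
    using that assms by (auto simp: var_def sum_nonneg_eq_0_iff)
  have lag: "t - int h \<in> ?S" if "1 \<le> t" "t \<le> int T" "h \<in> {0..k}" for t h
    using that by auto
  show thesis
  proof (cases "var f = 0")
    case True
    have "var real_of_int \<noteq> 0"
    proof
      assume *: "var real_of_int = 0"
      have "1 - int k \<in> ?S" "2 - int k \<in> ?S" using assms by auto
      with var0[OF *] have "real_of_int (1 - int k) = real_of_int (2 - int k)" by metis
      then show False by simp
    qed
    with nn[of real_of_int] have "var real_of_int > 0" by linarith
    from std[OF this] show thesis
      by (rule that[where a = "\<lambda>j. \<Sum>h=0..k. \<beta> h j * mu f" and b = "\<lambda>_ _. 0"])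
        (auto simp: reconstruction_def var0[OF True lag] intro!: sum.cong)
  next
    case False
    with nn[of f] have pos: "var f > 0" by linarith
    from std[OF this] show thesis
      by (rule that[where a = "\<lambda>j. \<Sum>h=0..k. \<beta> h j * mu f" and b = "\<lambda>h j. \<beta> h j * sqrt (var f)"])
        (use pos in \<open>auto simp: reconstruction_def field_simps simp flip: sum.distrib intro!: sum.cong\<close>)
  qed
qed

text \<open>
  Comparing the optimum with the exact reconstruction of the common part gives
  \<open>X \<le> -2 I\<close> for \<open>X = \<parallel>D\<parallel>\<^sup>2\<close> and \<open>I = \<langle>D, e\<rangle>\<close>. Since \<open>I\<^sup>2 \<le> (2k + 3) G X\<close> by low rank, the inequality
  \<open>X\<^sup>2 \<le> 4 I\<^sup>2\<close> can be divided by \<open>X\<close>.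
\<close>

lemma gdpc_error_bound:
  assumes gdpc: "is_first_gdpc k T m z g a b" and "1 \<le> T" "2 \<le> T + k" "1 \<le> m"
    and z: "\<And>t j. 1 \<le> j \<Longrightarrow> z t j = (\<Sum>h=0..k. \<beta> h j * f (t - int h)) + e t j"
  shows "(\<Sum>t=1..int T. (L2_set (\<lambda>j. (\<Sum>h=0..k. \<beta> h j * f (t - int h)) - reconstruction k g a b t j) {1..m})\<^sup>2)
    \<le> 4 * real (2 * k + 3) * sqrt (\<Sum>t=1..int T. \<Sum>s=1..int T. (\<Sum>j=1..m. e t j * e s j)\<^sup>2)"
proof -
  let ?A = "{1..int T}" and ?J = "{1..m}"
  define common where "common t j = (\<Sum>h=0..k. \<beta> h j * f (t - int h))" for t j
  define D where "D t j = common t j - reconstruction k g a b t j" for t j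
  define G where "G = sqrt (\<Sum>t\<in>?A. \<Sum>s\<in>?A. (\<Sum>j\<in>?J. e t j * e s j)\<^sup>2)"
  define X where "X = (\<Sum>j\<in>?J. \<Sum>t\<in>?A. (D t j)\<^sup>2)"
  define I where "I = (\<Sum>j\<in>?J. \<Sum>t\<in>?A. D t j * e t j)"
  have L2: "(L2_set h ?J)\<^sup>2 = (\<Sum>j\<in>?J. (h j)\<^sup>2)" for h :: "nat \<Rightarrow> real"
    by (simp add: L2_set_def sum_nonneg)
  obtain g' a' b' where g': "standardized k T g'"
    and rec: "\<And>t j. 1 \<le> t \<Longrightarrow> t \<le> int T \<Longrightarrow> reconstruction k g' a' b' t j = common t j"
    using exists_standardized_reconstruction[OF \<open>2 \<le> T + k\<close>, where \<beta> = \<beta> and f = f] unfolding common_def by blast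
  have "reconstruction_MSE k T m z g a b \<le> reconstruction_MSE k T m z g' a' b'"
    using gdpc g' by (simp add: is_first_gdpc_def)
  then have "(\<Sum>t\<in>?A. \<Sum>j\<in>?J. (z t j - reconstruction k g a b t j)\<^sup>2)
      \<le> (\<Sum>t\<in>?A. \<Sum>j\<in>?J. (z t j - reconstruction k g' a' b' t j)\<^sup>2)"
    using \<open>1 \<le> T\<close> \<open>1 \<le> m\<close> unfolding reconstruction_MSE_def L2
    by (subst (asm) mult_le_cancel_left_pos) simp_all
  also have "\<dots> = (\<Sum>t\<in>?A. \<Sum>j\<in>?J. (e t j)\<^sup>2)"
    by (intro sum.cong refl) (simp add: rec z common_def)
  also have "(\<Sum>t\<in>?A. \<Sum>j\<in>?J. (z t j - reconstruction k g a b t j)\<^sup>2)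
      = (\<Sum>t\<in>?A. \<Sum>j\<in>?J. (D t j)\<^sup>2 + 2 * (D t j * e t j) + (e t j)\<^sup>2)"
    by (intro sum.cong refl) (simp add: z D_def common_def power2_eq_square algebra_simps)
  also have "\<dots> = X + 2 * I + (\<Sum>t\<in>?A. \<Sum>j\<in>?J. (e t j)\<^sup>2)"
    unfolding X_def I_def sum.swap[of _ ?A ?J] by (simp add: sum.distrib sum_distrib_left)
  finally have basic: "X \<le> - 2 * I" by simp
  \<comment> \<open>The rank-one terms of \<open>D\<close>: tag 0 for lags of the true factor, tag 1 for lags of the fitted
    factor, and a single term with tag 2 for the intercept.\<close>
  define R where "R = insert (2, 0) (({0, 1} :: nat set) \<times> {0..k})"
  define c where "c r t = (if fst r = 0 then f (t - int (snd r))
      else if fst r = 1 then g (t - int (snd r)) else 1)" for r :: "nat \<times> nat" and t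
  define v where "v r j = (if fst r = 0 then \<beta> (snd r) j
      else if fst r = 1 then - b (snd r) j else - a j)" for r :: "nat \<times> nat" and j
  have fin: "finite R" and card: "card R = 2 * k + 3" by (simp_all add: R_def)
  have D: "D t j = (\<Sum>r\<in>R. c r t * v r j)" for t j
  proof -
    have "(\<Sum>r\<in>R. c r t * v r j)
        = - a j + (\<Sum>r\<in>{0, 1} \<times> {0..k}. c r t * v r j)"
      by (simp add: R_def) (simp add: c_def v_def)
    also have "(\<Sum>r\<in>{0, 1} \<times> {0..k}. c r t * v r j)
        = (\<Sum>i\<in>{0, 1}. \<Sum>h=0..k. c (i, h) t * v (i, h) j)"
      by (simp only: sum.cartesian_product case_prod_unfold prod.collapse)
    also have "- a j + (\<Sum>i\<in>{0, 1}. \<Sum>h=0..k. c (i, h) t * v (i, h) j) = D t j"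
      by (simp add: c_def v_def D_def common_def reconstruction_def sum_negf mult_ac)
    finally show ?thesis ..
  qed
  have "I\<^sup>2 \<le> real (2 * k + 3) * G * X"
    unfolding I_def X_def card[symmetric]
    by (rule low_rank_inner_product_bound[OF fin _ _ _ D]) (auto simp: G_def sum_nonneg operator_norm_le_gram)
  moreover have "0 \<le> X" by (simp add: X_def sum_nonneg)
  then have "X\<^sup>2 \<le> (- 2 * I)\<^sup>2" using basic by (intro power_mono)
  ultimately have "X * X \<le> (4 * real (2 * k + 3) * G) * X" by (simp add: power2_eq_square algebra_simps)
  moreover have "0 \<le> 4 * real (2 * k + 3) * G" by (simp add: G_def sum_nonneg)
  ultimately have "X \<le> 4 * real (2 * k + 3) * G"
    using \<open>0 \<le> X\<close> by (cases "X = 0") auto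
  then show ?thesis
    unfolding L2 by (subst sum.swap) (simp add: X_def D_def common_def G_def)
qed

section \<open>Moments of the noise Gram matrix\<close>

lemma limsup_ennreal_finite_bound:
  fixes u :: "nat \<Rightarrow> ennreal"
  assumes "limsup u < \<infinity>"
  obtains C n0 where "0 \<le> C" "\<And>n. n \<ge> n0 \<Longrightarrow> u n \<le> ennreal C"
proof -
  obtain c where c: "limsup u < c" "c < \<infinity>" using dense[OF assms] by blast
  from Limsup_lessD[OF c(1)] obtain n0 where "\<forall>n\<ge>n0. u n < c"
    by (auto simp: eventually_sequentially)
  moreover from c(2) have "c = ennreal (enn2real c)" by (simp add: less_top)
  ultimately show thesis
    by (intro that[of "enn2real c" n0]) (auto intro: less_imp_le)
qed

context prob_space
begin

lemma integrable_product:
  fixes X Y :: "'a \<Rightarrow> real"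
  assumes [measurable]: "X \<in> borel_measurable M" "Y \<in> borel_measurable M"
    and "integrable M (\<lambda>\<omega>. (X \<omega>)\<^sup>2)" "integrable M (\<lambda>\<omega>. (Y \<omega>)\<^sup>2)"
  shows "integrable M (\<lambda>\<omega>. X \<omega> * Y \<omega>)"
proof (rule Bochner_Integration.integrable_bound)
  show "integrable M (\<lambda>\<omega>. (X \<omega>)\<^sup>2 + (Y \<omega>)\<^sup>2)" using assms by simp
  have "\<bar>x * y\<bar> \<le> x\<^sup>2 + y\<^sup>2" for x y :: real
    using sum_squares_bound[of x y] sum_squares_bound[of x "- y"] 
      zero_le_power2[of x] zero_le_power2[of y] by (simp add: abs_le_iff)
  then show "AE \<omega> in M. norm (X \<omega> * Y \<omega>) \<le> norm ((X \<omega>)\<^sup>2 + (Y \<omega>)\<^sup>2)" by simp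
qed simp

lemma cov_eq:
  assumes [measurable]: "X \<in> borel_measurable M" "Y \<in> borel_measurable M"
    and sq: "integrable M (\<lambda>\<omega>. (X \<omega>)\<^sup>2)" "integrable M (\<lambda>\<omega>. (Y \<omega>)\<^sup>2)"
  shows "cov M X Y = expectation (\<lambda>\<omega>. X \<omega> * Y \<omega>) - expectation X * expectation Y"
proof -
  have [simp]: "integrable M (\<lambda>\<omega>. X \<omega> * Y \<omega>)" "integrable M X" "integrable M Y"
    using integrable_product[OF assms] sq by (auto intro: square_integrable_imp_integrable)
  have "cov M X Y = expectation (\<lambda>\<omega>. X \<omega> * Y \<omega> - expectation Y * X \<omega> - expectation X * Y \<omega>
      + expectation X * expectation Y)"
    by (simp add: cov_def algebra_simps)
  also have "\<dots> = expectation (\<lambda>\<omega>. X \<omega> * Y \<omega>) - expectation X * expectation Y"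
    by (simp add: prob_space)
  finally show ?thesis .
qed

text \<open>
  The second moment splits into squared mean and variance; the two parts are small for different
  reasons when applied to the entries of the Gram matrix.
\<close>

lemma second_moment_sum_le:
  fixes X :: "'i \<Rightarrow> 'a \<Rightarrow> real"
  assumes meas: "\<And>j. j \<in> J \<Longrightarrow> X j \<in> borel_measurable M"
    and sq: "\<And>j. j \<in> J \<Longrightarrow> integrable M (\<lambda>\<omega>. (X j \<omega>)\<^sup>2)"
  shows "integrable M (\<lambda>\<omega>. (\<Sum>j\<in>J. X j \<omega>)\<^sup>2)"
    and "expectation (\<lambda>\<omega>. (\<Sum>j\<in>J. X j \<omega>)\<^sup>2)
      \<le> (expectation (\<lambda>\<omega>. \<Sum>j\<in>J. X j \<omega>))\<^sup>2 + (\<Sum>j\<in>J. \<Sum>i\<in>J. \<bar>cov M (X i) (X j)\<bar>)"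
proof -
  have prod: "integrable M (\<lambda>\<omega>. X i \<omega> * X j \<omega>)" if "i \<in> J" "j \<in> J" for i j
    by (rule integrable_product[OF meas[OF that(1)] meas[OF that(2)] sq[OF that(1)] sq[OF that(2)]])
  have int: "integrable M (X j)" if "j \<in> J" for j
    by (rule square_integrable_imp_integrable[OF meas[OF that] sq[OF that]])
  have eq: "(\<Sum>j\<in>J. X j \<omega>)\<^sup>2 = (\<Sum>j\<in>J. \<Sum>i\<in>J. X i \<omega> * X j \<omega>)" for \<omega>
    unfolding power2_eq_square sum_product by (rule sum.swap)
  show "integrable M (\<lambda>\<omega>. (\<Sum>j\<in>J. X j \<omega>)\<^sup>2)"
    unfolding eq by (intro Bochner_Integration.integrable_sum prod)
  have "expectation (\<lambda>\<omega>. (\<Sum>j\<in>J. X j \<omega>)\<^sup>2)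
      = (\<Sum>j\<in>J. \<Sum>i\<in>J. expectation (\<lambda>\<omega>. X i \<omega> * X j \<omega>))"
    unfolding eq by (simp add: Bochner_Integration.integral_sum Bochner_Integration.integrable_sum prod)
  also have "\<dots> = (\<Sum>j\<in>J. \<Sum>i\<in>J. expectation (X i) * expectation (X j) + cov M (X i) (X j))"
    by (intro sum.cong refl) (simp add: cov_eq meas sq)
  also have "\<dots> = (\<Sum>j\<in>J. expectation (X j))\<^sup>2 + (\<Sum>j\<in>J. \<Sum>i\<in>J. cov M (X i) (X j))"
    unfolding sum.distrib power2_eq_square sum_product
    by (intro arg_cong2[where f = "(+)"] sum.swap refl)
  also have "(\<Sum>j\<in>J. expectation (X j)) = expectation (\<lambda>\<omega>. \<Sum>j\<in>J. X j \<omega>)"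
    by (simp add: int)
  finally show "expectation (\<lambda>\<omega>. (\<Sum>j\<in>J. X j \<omega>)\<^sup>2)
      \<le> (expectation (\<lambda>\<omega>. \<Sum>j\<in>J. X j \<omega>))\<^sup>2 + (\<Sum>j\<in>J. \<Sum>i\<in>J. \<bar>cov M (X i) (X j)\<bar>)"
    by (auto intro!: sum_mono)
qed

text \<open>
  Off-diagonal decay of the mean of \<open>e\<^sub>t' e\<^sub>s\<close> makes the squared means of each of the \<open>T\<close> rows sum
  to \<open>B\<close> at most, whatever \<open>T\<close>; for the variances only the uniform bound \<open>C\<close> on each of the
  \<open>T\<^sup>2\<close> entries is available.
\<close>

lemma expected_gram_le:
  fixes e :: "int \<Rightarrow> 'j \<Rightarrow> 'a \<Rightarrow> real"
  assumes meas: "\<And>t j. j \<in> J \<Longrightarrow> e t j \<in> borel_measurable M"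
    and sq: "\<And>t s j. j \<in> J \<Longrightarrow> integrable M (\<lambda>\<omega>. (e t j \<omega> * e s j \<omega>)\<^sup>2)"
    and mean: "\<And>t s. expectation (\<lambda>\<omega>. \<Sum>j\<in>J. e t j \<omega> * e s j \<omega>) = \<gamma> (s - t)"
    and \<gamma>: "\<And>F. finite F \<Longrightarrow> (\<Sum>u\<in>F. (\<gamma> u)\<^sup>2) \<le> B"
    and cov: "\<And>t s. (\<Sum>j\<in>J. \<Sum>i\<in>J.
        \<bar>cov M (\<lambda>\<omega>. e t i \<omega> * e s i \<omega>) (\<lambda>\<omega>. e t j \<omega> * e s j \<omega>)\<bar>) \<le> C"
  shows "integrable M (\<lambda>\<omega>. \<Sum>t=1..int T. \<Sum>s=1..int T. (\<Sum>j\<in>J. e t j \<omega> * e s j \<omega>)\<^sup>2)"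
    and "expectation (\<lambda>\<omega>. \<Sum>t=1..int T. \<Sum>s=1..int T. (\<Sum>j\<in>J. e t j \<omega> * e s j \<omega>)\<^sup>2)
      \<le> real T * B + (real T)\<^sup>2 * C"
proof -
  let ?A = "{1..int T}"
  have prods: "(\<lambda>\<omega>. e t j \<omega> * e s j \<omega>) \<in> borel_measurable M" if "j \<in> J" for t s j
    using meas[OF that] by measurable
  note moment = second_moment_sum_le[OF prods sq]
  show "integrable M (\<lambda>\<omega>. \<Sum>t\<in>?A. \<Sum>s\<in>?A. (\<Sum>j\<in>J. e t j \<omega> * e s j \<omega>)\<^sup>2)"
    by (intro Bochner_Integration.integrable_sum moment(1))
  have "expectation (\<lambda>\<omega>. \<Sum>t\<in>?A. \<Sum>s\<in>?A. (\<Sum>j\<in>J. e t j \<omega> * e s j \<omega>)\<^sup>2)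
      = (\<Sum>t\<in>?A. \<Sum>s\<in>?A. expectation (\<lambda>\<omega>. (\<Sum>j\<in>J. e t j \<omega> * e s j \<omega>)\<^sup>2))"
    by (simp add: Bochner_Integration.integral_sum Bochner_Integration.integrable_sum moment(1))
  also have "\<dots> \<le> (\<Sum>t\<in>?A. \<Sum>s\<in>?A. (\<gamma> (s - t))\<^sup>2 + C)"
    by (intro sum_mono order.trans[OF moment(2)] add_mono cov) (simp_all add: mean)
  also have "\<dots> = (\<Sum>t\<in>?A. \<Sum>s\<in>?A. (\<gamma> (s - t))\<^sup>2) + (real T)\<^sup>2 * C"
    by (simp add: sum.distrib power2_eq_square)
  also have "(\<Sum>t\<in>?A. \<Sum>s\<in>?A. (\<gamma> (s - t))\<^sup>2) \<le> (\<Sum>t\<in>?A. B)"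
  proof (rule sum_mono)
    fix t
    have "(\<Sum>s\<in>?A. (\<gamma> (s - t))\<^sup>2) = (\<Sum>u\<in>(\<lambda>s. s - t) ` ?A. (\<gamma> u)\<^sup>2)"
      by (subst sum.reindex) (auto simp: inj_on_def)
    also have "\<dots> \<le> B" by (rule \<gamma>) simp
    finally show "(\<Sum>s\<in>?A. (\<gamma> (s - t))\<^sup>2) \<le> B" .
  qed
  finally show "expectation (\<lambda>\<omega>. \<Sum>t\<in>?A. \<Sum>s\<in>?A. (\<Sum>j\<in>J. e t j \<omega> * e s j \<omega>)\<^sup>2)
      \<le> real T * B + (real T)\<^sup>2 * C" by simp
qed

end

section \<open>The rate\<close>

text \<open>
  \<open>X > c\<close> forces \<open>Y \<ge> c\<^sup>2 / K\<^sup>2\<close>, so the moment of \<open>Y\<close> controls \<open>X\<close> by Markov's inequality.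
\<close>

lemma prob_sqrt_bound:
  assumes "prob_space M" and int: "integrable M Y" and Y0: "\<And>\<omega>. 0 \<le> Y \<omega>" and "0 < K" "0 < c"
    and X: "AE \<omega> in M. \<bar>X \<omega>\<bar> \<le> K * sqrt (Y \<omega>)"
  shows "measure M {\<omega>\<in>space M. \<bar>X \<omega>\<bar> > c} \<le> K\<^sup>2 * (\<integral>\<omega>. Y \<omega> \<partial>M) / c\<^sup>2"
proof -
  interpret prob_space M by fact
  have [measurable]: "Y \<in> borel_measurable M" using int by simp
  have "measure M {\<omega>\<in>space M. \<bar>X \<omega>\<bar> > c} \<le> measure M {\<omega>\<in>space M. Y \<omega> \<ge> c\<^sup>2 / K\<^sup>2}"
  proof (rule finite_measure_mono_AE)
    show "AE \<omega> in M. \<omega> \<in> {\<omega>\<in>space M. \<bar>X \<omega>\<bar> > c} \<longrightarrow> \<omega> \<in> {\<omega>\<in>space M. Y \<omega> \<ge> c\<^sup>2 / K\<^sup>2}"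
      using X
    proof (eventually_elim, safe)
      fix \<omega> assume "\<bar>X \<omega>\<bar> \<le> K * sqrt (Y \<omega>)" "\<bar>X \<omega>\<bar> > c"
      then have "c\<^sup>2 \<le> (K * sqrt (Y \<omega>))\<^sup>2" using \<open>0 < c\<close> by (intro power_mono) auto
      then show "c\<^sup>2 / K\<^sup>2 \<le> Y \<omega>"
        using Y0[of \<omega>] \<open>0 < K\<close> by (simp add: power_mult_distrib divide_le_eq mult.commute)
    qed
  qed measurable
  also have "\<dots> \<le> (\<integral>\<omega>. Y \<omega> \<partial>M) / (c\<^sup>2 / K\<^sup>2)"
    using assms by (intro integral_Markov_inequality_measure[where A = "space M"]) auto
  finally show ?thesis by (simp add: mult.commute)
qed

text \<open>
  The squared rate on the right is \<open>min (T, m) powr (-1/2)\<close>, while the left side is only of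
  order \<open>1 / min (T, m)\<close>: comparing each fraction with \<open>min (T, m) powr (-1/2)\<close> is enough.
\<close>

lemma sum_inverse_le_rate:
  assumes "1 \<le> T" "1 \<le> m"
  shows "1 / real T + 1 / real m \<le> 2 * (1 / min (real T powr (1/4)) (real m powr (1/4)))\<^sup>2"
proof -
  let ?n = "min (real T powr (1/4)) (real m powr (1/4))"
  have pos: "0 < ?n" using assms by simp
  have "1 / real N \<le> (1 / ?n)\<^sup>2" if "?n \<le> real N powr (1/4)" "1 \<le> N" for N
  proof -
    have "?n\<^sup>2 \<le> (real N powr (1/4))\<^sup>2" using that(1) pos by (intro power_mono) auto
    also have "\<dots> = real N powr (1/2)" by (simp add: power2_eq_square flip: powr_add)
    also have "\<dots> \<le> real N powr 1" using that(2) by (intro powr_mono) auto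
    finally have "?n\<^sup>2 \<le> real N" using that(2) by simp
    with zero_less_power[OF pos, of 2] show ?thesis
      unfolding power_one_over by (intro frac_le) simp_all
  qed
  from this[of T] this[of m] show ?thesis using assms by simp
qed

theorem theorem1:
  fixes M :: "'a measure"
    and k :: nat
    and \<beta> :: "nat \<Rightarrow> nat \<Rightarrow> real"
    and f :: "int \<Rightarrow> 'a \<Rightarrow> real"
    and e z :: "int \<Rightarrow> nat \<Rightarrow> 'a \<Rightarrow> real"
    and fhat :: "nat \<Rightarrow> nat \<Rightarrow> int \<Rightarrow> 'a \<Rightarrow> real"
    and ahat :: "nat \<Rightarrow> nat \<Rightarrow> nat \<Rightarrow> 'a \<Rightarrow> real"
    and bhat :: "nat \<Rightarrow> nat \<Rightarrow> nat \<Rightarrow> nat \<Rightarrow> 'a \<Rightarrow> real"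
  assumes prob: "prob_space M"
    and model: "\<And>t j \<omega>. 1 \<le> j \<Longrightarrow> \<omega> \<in> space M \<Longrightarrow>
      z t j \<omega> = (\<Sum>h=0..k. \<beta> h j * f (t - int h) \<omega>) + e t j \<omega>"
    and a1_chi: "\<And>m. zero_mean M {1..m} (common_part k \<beta> f) \<and> second_order_stationary M {1..m} (common_part k \<beta> f) \<and>
      has_spectral_density M {1..m} (common_part k \<beta> f)"
    and a1_e: "\<And>m. zero_mean M {1..m} e \<and> second_order_stationary M {1..m} e \<and>
      has_spectral_density M {1..m} e"
    and b1_stationary: "second_order_stationary M {0..k} (lag_vector f)"
    and b1_uncorrelated: "\<And>t h j. h \<le> k \<Longrightarrow> 1 \<le> j \<Longrightarrow> cov M (lag_vector f t h) (e t j) = 0"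
    and c1_chi: "\<And>t. sup_eigenvalue M (common_part k \<beta> f) t (k + 1) = \<infinity>"
    and c1_e: "\<And>t. sup_eigenvalue M e t 1 < \<infinity>"
    and a2: "\<And>h l. h \<le> k \<Longrightarrow> l \<le> k \<Longrightarrow>
      (\<lambda>m. (\<Sum>j=1..m. \<beta> h j * \<beta> l j) / real m) \<longlonglongrightarrow> (if h = l then 1 else 0)"
    and b2: "\<And>t. limsup (\<lambda>m. \<Sum>\<^sub>\<infinity>u\<in>(UNIV :: int set).
        ennreal (((\<integral>\<omega>. (\<Sum>j=1..m. e t j \<omega> * e (t + u) j \<omega>) \<partial>M) / real m)\<^sup>2)) < \<infinity>"
    and c2_moments: "\<And>t s i. 1 \<le> i \<Longrightarrow> integrable M (\<lambda>\<omega>. (e t i \<omega> * e s i \<omega>)\<^sup>2)"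
    and c2: "limsup (\<lambda>m. ennreal (1 / real m) * (SUP (t :: int, s :: int)\<in>UNIV.
        ennreal (\<Sum>j=1..m. \<Sum>i=1..m.
          \<bar>cov M (\<lambda>\<omega>. e t i \<omega> * e s i \<omega>) (\<lambda>\<omega>. e t j \<omega> * e s j \<omega>)\<bar>))) < \<infinity>"
    and fhat_measurable: "\<And>T m s. 1 - int k \<le> s \<Longrightarrow> s \<le> int T \<Longrightarrow> fhat T m s \<in> borel_measurable M"
    and ahat_measurable: "\<And>T m j. 1 \<le> j \<Longrightarrow> j \<le> m \<Longrightarrow> ahat T m j \<in> borel_measurable M"
    and bhat_measurable: "\<And>T m h j. h \<le> k \<Longrightarrow> 1 \<le> j \<Longrightarrow> j \<le> m \<Longrightarrow>
      bhat T m h j \<in> borel_measurable M"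
    and gdpc: "\<And>T m. 1 \<le> T \<Longrightarrow> 2 \<le> T + k \<Longrightarrow> 1 \<le> m \<Longrightarrow> AE \<omega> in M.
      is_first_gdpc k T m (\<lambda>t j. z t j \<omega>)
        (\<lambda>s. fhat T m s \<omega>) (\<lambda>j. ahat T m j \<omega>) (\<lambda>h j. bhat T m h j \<omega>)"
  shows "bigO_P M
    (\<lambda>T m \<omega>. 1 / (real T * real m) * (\<Sum>t=1..int T.
       (L2_set (\<lambda>j. common_part k \<beta> f t j \<omega> -
          reconstruction k (\<lambda>s. fhat T m s \<omega>) (\<lambda>j. ahat T m j \<omega>) (\<lambda>h j. bhat T m h j \<omega>) t j)
        {1..m})\<^sup>2))
    (\<lambda>T m. 1 / min (real T powr (1/4)) (real m powr (1/4)))"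
proof -
  interpret prob_space M by fact
  define \<gamma> where "\<gamma> m u = expectation (\<lambda>\<omega>. \<Sum>j=1..m. e 0 j \<omega> * e u j \<omega>)" for m :: nat and u :: int
  define v where "v m t s = (\<Sum>j=1..m. \<Sum>i=1..m.
      \<bar>cov M (\<lambda>\<omega>. e t i \<omega> * e s i \<omega>) (\<lambda>\<omega>. e t j \<omega> * e s j \<omega>)\<bar>)" for m :: nat and t s :: int
  define Y where "Y T m \<omega> = (\<Sum>t=1..int T. \<Sum>s=1..int T. (\<Sum>j=1..m. e t j \<omega> * e s j \<omega>)\<^sup>2)"
    for T m :: nat and \<omega>
  define a where "a T m = 1 / min (real T powr (1/4)) (real m powr (1/4))" for T m :: nat
  define X where "X T m \<omega> = 1 / (real T * real m) * (\<Sum>t=1..int T.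
       (L2_set (\<lambda>j. common_part k \<beta> f t j \<omega> -
          reconstruction k (\<lambda>s. fhat T m s \<omega>) (\<lambda>j. ahat T m j \<omega>) (\<lambda>h j. bhat T m h j \<omega>) t j)
        {1..m})\<^sup>2)" for T m \<omega>

  have e_meas: "e t j \<in> borel_measurable M" and e_sq: "integrable M (\<lambda>\<omega>. (e t j \<omega>)\<^sup>2)"
    and e_mean: "expectation (e t j) = 0" if "1 \<le> j" for t j
    using a1_e[of j] that by (auto simp: zero_mean_def second_order_stationary_def)
  have e_stat: "expectation (\<lambda>\<omega>. e t j \<omega> * e s j \<omega>) = expectation (\<lambda>\<omega>. e 0 j \<omega> * e (s - t) j \<omega>)"
    if "1 \<le> j" for t s j
  proof -
    have "cov M (e (t + (s - t)) j) (e t j) = cov M (e (0 + (s - t)) j) (e 0 j)"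
      using a1_e[of j] that unfolding second_order_stationary_def by (meson atLeastAtMost_iff order_refl)
    then show ?thesis using that by (simp add: cov_def e_mean mult.commute)
  qed
  have mean: "expectation (\<lambda>\<omega>. \<Sum>j=1..m. e t j \<omega> * e s j \<omega>) = \<gamma> m (s - t)" for m t s
  proof -
    have "integrable M (\<lambda>\<omega>. e t j \<omega> * e s j \<omega>)" if "1 \<le> j" for t s j
      using that by (intro integrable_product e_meas e_sq)
    then show ?thesis by (simp add: \<gamma>_def Bochner_Integration.integral_sum e_stat[of _ t s])
  qed

  \<comment> \<open>By stationarity the means of \<open>e\<^sub>t' e\<^sub>s\<close> are those at time 0, so square summability at time 0
    serves all rows of the Gram matrix.\<close>
  obtain B m1 where "0 \<le> B"
    and B: "\<And>m. m \<ge> m1 \<Longrightarrow> (\<Sum>\<^sub>\<infinity>u\<in>UNIV. ennreal ((\<gamma> m u / real m)\<^sup>2)) \<le> ennreal B"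
    using limsup_ennreal_finite_bound[OF b2[of 0]] unfolding \<gamma>_def by auto
  have \<gamma>_le: "(\<Sum>u\<in>F. (\<gamma> m u)\<^sup>2) \<le> (real m)\<^sup>2 * B" if "m \<ge> m1" "m \<ge> 1" "finite F" for m F
  proof -
    have "ennreal (\<Sum>u\<in>F. (\<gamma> m u / real m)\<^sup>2) = (\<Sum>\<^sub>\<infinity>u\<in>F. ennreal ((\<gamma> m u / real m)\<^sup>2))"
      using that by (simp add: sum_ennreal)
    also have "\<dots> \<le> (\<Sum>\<^sub>\<infinity>u\<in>UNIV. ennreal ((\<gamma> m u / real m)\<^sup>2))"
      by (intro infsum_mono_neutral nonneg_summable_on_complete) auto
    also have "\<dots> \<le> ennreal B" using B that by simp
    finally have "(\<Sum>u\<in>F. (\<gamma> m u / real m)\<^sup>2) \<le> B" using \<open>0 \<le> B\<close> by (simp add: ennreal_le_iff)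
    then show ?thesis
      using that(2) by (simp add: power_divide divide_le_eq mult.commute flip: sum_divide_distrib)
  qed

  obtain C m2 where "0 \<le> C"
    and C: "\<And>m. m \<ge> m2 \<Longrightarrow> ennreal (1 / real m) * (SUP (t, s)\<in>UNIV. ennreal (v m t s)) \<le> ennreal C"
    using limsup_ennreal_finite_bound[OF c2] unfolding v_def by auto
  have v_le: "v m t s \<le> real m * C" if "m \<ge> m2" "m \<ge> 1" for m t s
  proof -
    have "0 \<le> v m t s" by (simp add: v_def sum_nonneg)
    then have "ennreal (1 / real m * v m t s) = ennreal (1 / real m) * ennreal (v m t s)"
      by (intro ennreal_mult) simp_all
    also have "\<dots> \<le> ennreal (1 / real m) * (SUP (t, s)\<in>UNIV. ennreal (v m t s))"
      by (intro mult_left_mono SUP_upper2[where i = "(t, s)"]) auto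
    also have "\<dots> \<le> ennreal C" using C that by simp
    finally have "1 / real m * v m t s \<le> C" using \<open>0 \<le> C\<close> by (simp add: ennreal_le_iff)
    then show ?thesis using that(2) by (simp add: divide_le_eq mult.commute)
  qed

  define A where "A = B + C"
  have A: "0 \<le> A" "B \<le> A" "C \<le> A" using \<open>0 \<le> B\<close> \<open>0 \<le> C\<close> by (simp_all add: A_def)
  have Y: "integrable M (Y T m)" "expectation (Y T m) \<le> (real T * real m)\<^sup>2 * (2 * A * (a T m)\<^sup>2)"
    if "1 \<le> T" "1 \<le> m" "m1 \<le> m" "m2 \<le> m" for T m
  proof -
    have cov: "(\<Sum>j=1..m. \<Sum>i=1..m. \<bar>cov M (\<lambda>\<omega>. e t i \<omega> * e s i \<omega>) (\<lambda>\<omega>. e t j \<omega> * e s j \<omega>)\<bar>)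
        \<le> real m * C" for t s
      using v_le[of m t s] that by (simp add: v_def)
    have gram: "integrable M (Y T m)"
      "expectation (Y T m) \<le> real T * ((real m)\<^sup>2 * B) + (real T)\<^sup>2 * (real m * C)"
      unfolding Y_def
      using expected_gram_le[where J = "{1..m}" and e = e, OF e_meas c2_moments mean \<gamma>_le[OF that(3,2)] cov]
      by auto
    show "integrable M (Y T m)" by fact
    have "real T * ((real m)\<^sup>2 * B) + (real T)\<^sup>2 * (real m * C)
        = (real T * real m)\<^sup>2 * (B * (1 / real T) + C * (1 / real m))"
      using that by (simp add: field_simps power2_eq_square)
    also have "\<dots> \<le> (real T * real m)\<^sup>2 * (A * (1 / real T + 1 / real m))"
      unfolding distrib_left[of A] using A
      by (intro mult_left_mono add_mono mult_right_mono) simp_all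
    also have "\<dots> \<le> (real T * real m)\<^sup>2 * (A * (2 * (a T m)\<^sup>2))"
      using A sum_inverse_le_rate[OF that(1,2)] unfolding a_def
      by (intro mult_left_mono zero_le_power2)
    finally show "expectation (Y T m) \<le> (real T * real m)\<^sup>2 * (2 * A * (a T m)\<^sup>2)"
      using gram(2) by (simp add: mult_ac)
  qed

  define K where "K = 4 * real (2 * k + 3)"
  have "K > 0" by (simp add: K_def)
  have XY: "AE \<omega> in M. \<bar>X T m \<omega>\<bar> \<le> K / (real T * real m) * sqrt (Y T m \<omega>)"
    if "2 \<le> T" "1 \<le> m" for T m
  proof -
    have "1 \<le> T" "2 \<le> T + k" using that by auto
    from gdpc[OF this that(2)] AE_space show ?thesis
    proof eventually_elim
      case (elim \<omega>)
      have "\<bar>X T m \<omega>\<bar> = 1 / (real T * real m) * (\<Sum>t=1..int T.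
         (L2_set (\<lambda>j. (\<Sum>h=0..k. \<beta> h j * f (t - int h) \<omega>) -
          reconstruction k (\<lambda>s. fhat T m s \<omega>) (\<lambda>j. ahat T m j \<omega>) (\<lambda>h j. bhat T m h j \<omega>) t j)
        {1..m})\<^sup>2)"
        by (simp add: X_def common_part_def lag_vector_def sum_nonneg)
      also have "\<dots> \<le> 1 / (real T * real m) * (K * sqrt (Y T m \<omega>))"
        unfolding K_def Y_def using elim
        by (intro mult_left_mono gdpc_error_bound[OF elim(1) \<open>1 \<le> T\<close> \<open>2 \<le> T + k\<close> \<open>1 \<le> m\<close>] model) auto
      finally show ?case by simp
    qed
  qed

  have "bigO_P M X a"
    unfolding bigO_P_def
  proof (intro allI impI)
    fix \<epsilon> :: real assume "\<epsilon> > 0"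
    \<comment> \<open>Markov's inequality will give the bound \<open>2 K\<^sup>2 A / c\<^sup>2\<close>, which this \<open>c\<close> brings below \<open>\<epsilon>\<close>;
      adding 1 makes the inequality strict and \<open>c\<close> positive.\<close>
    define c where "c = sqrt (2 * K\<^sup>2 * A / \<epsilon>) + 1"
    have root: "0 \<le> 2 * K\<^sup>2 * A / \<epsilon>"
      using \<open>\<epsilon> > 0\<close> A by simp
    then have "c > 0" by (simp add: c_def add_nonneg_pos)
    have "(sqrt (2 * K\<^sup>2 * A / \<epsilon>))\<^sup>2 < c\<^sup>2"
      using root unfolding c_def by (intro power_strict_mono) auto
    then have c2: "2 * K\<^sup>2 * A / c\<^sup>2 < \<epsilon>"
      using root \<open>\<epsilon> > 0\<close> \<open>c > 0\<close> by (simp add: divide_less_eq mult.commute)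
    \<comment> \<open>\<open>T \<ge> 2\<close> guarantees two sample points of the factor even when \<open>k = 0\<close>.\<close>
    have "prob {\<omega>\<in>space M. \<bar>X T m \<omega>\<bar> > c * a T m} < \<epsilon>"
      if "2 \<le> T" "max 1 (max m1 m2) \<le> m" for T m
    proof -
      have Tm: "1 \<le> T" "1 \<le> m" "m1 \<le> m" "m2 \<le> m" using that by auto
      then have "a T m > 0" by (simp add: a_def)
      have "prob {\<omega>\<in>space M. \<bar>X T m \<omega>\<bar> > c * a T m}
          \<le> (K / (real T * real m))\<^sup>2 * expectation (Y T m) / (c * a T m)\<^sup>2"
        using Tm \<open>K > 0\<close> \<open>c > 0\<close> \<open>a T m > 0\<close>
        by (intro prob_sqrt_bound prob Y(1) XY that) (auto simp: Y_def sum_nonneg)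
      also have "\<dots> \<le> (K / (real T * real m))\<^sup>2 * ((real T * real m)\<^sup>2 * (2 * A * (a T m)\<^sup>2)) / (c * a T m)\<^sup>2"
        using Y(2)[OF Tm] by (intro divide_right_mono mult_left_mono) auto
      also have "\<dots> = 2 * K\<^sup>2 * A / c\<^sup>2"
        using Tm \<open>a T m > 0\<close> by (simp add: power_divide power_mult_distrib)
      finally show ?thesis using c2 by linarith
    qed
    then show "\<exists>c T0 m0. \<forall>T\<ge>T0. \<forall>m\<ge>m0. prob {\<omega>\<in>space M. \<bar>X T m \<omega>\<bar> > c * a T m} < \<epsilon>" by blast
  qed
  then show ?thesis by (simp add: X_def[abs_def] a_def[abs_def])
qed

end
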